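(* An integral domain $R$ is a $v$-G-PID if and only if $R$ is a dually compact (DC) Schreier domain.
   Context: Let $K$ be the quotient field of $R$, $F(R)$ the set of nonzero fractional ideals of $R$, and $(a)=aR$ for $a\in K$. For $A\in F(R)$, $A^{-1}=\{x\in K: xA\subseteq R\}$ and $A_v=(A^{-1})^{-1}$. $R$ is a $v$-G-PID if $A_v$ is principal for each nonzero ideal $A$ of $R$. $R$ is dually compact (DC) if for every nonempty set $\{a_\alpha\}_{\alpha\in I}\subseteq K\setminus\{0\}$ with $\bigcap_{\alpha\in I}(a_\alpha)\neq(0)$ there is a finite set $\{x_1,\dots,x_n\}\subseteq K\setminus\{0\}$ with $\bigcap_{\alpha\in I}(a_\alpha)=\bigcap_{i=1}^n(x_i)$. An element $x\in R$ is primal if for all $y,z\in R$, $x\mid yz$ implies $x=rs$ with $r,s\in R$, $r\mid y$ and $s\mid z$. $R$ is a Schreier domain if it is integrally closed and all its nonzero elements are primal. *)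

theory Defs
  imports "HOL-Computational_Algebra.Polynomial_Factorial"
begin

text \<open>
  The integral domain \<open>R\<close> is a type \<open>'a :: idom\<close>, its quotient field \<open>K\<close> is \<open>'a fract\<close>, and
  \<open>R\<close> is embedded in \<open>K\<close> by \<^const>\<open>to_fract\<close>. Properties of \<open>R\<close> as a whole are predicates on
  \<open>'a itself\<close>.
\<close>

definition base_ring :: "'a::idom fract set" where
  "base_ring = range to_fract"

text \<open>The principal fractional ideal \<open>(a) = aR\<close>; it is zero for \<open>a = 0\<close>.\<close>

definition principal :: "'a::idom fract \<Rightarrow> 'a fract set" where
  "principal a = (*) a ` base_ring"

text \<open>
  \<open>A\<^sup>-\<^sup>1\<close> and \<open>A\<^sub>v\<close>, meant for nonzero fractional ideals \<open>A\<close> but defined for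
  all subsets of \<open>K\<close>.
\<close>

definition frac_inverse :: "'a::idom fract set \<Rightarrow> 'a fract set" where
  "frac_inverse A = {x. (*) x ` A \<subseteq> base_ring}"

definition v_closure :: "'a::idom fract set \<Rightarrow> 'a fract set" where
  "v_closure A = frac_inverse (frac_inverse A)"

text \<open>Ideals of \<open>R\<close> are the submodules of \<open>R\<close> as a module over itself.\<close>

definition ring_ideal :: "'a::comm_ring_1 set \<Rightarrow> bool" where
  "ring_ideal A \<longleftrightarrow> module.subspace (*) A"

lemma ring_ideal_iff:
  "ring_ideal A \<longleftrightarrow> 0 \<in> A \<and> (\<forall>x\<in>A. \<forall>y\<in>A. x + y \<in> A) \<and> (\<forall>r. \<forall>x\<in>A. r * x \<in> A)"
proof -
  have "module ((*) :: 'a \<Rightarrow> 'a \<Rightarrow> 'a)"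
    by unfold_locales (simp_all add: algebra_simps)
  then show ?thesis
    unfolding ring_ideal_def by (rule module.subspace_def)
qed

definition v_G_PID :: "'a::idom itself \<Rightarrow> bool" where
  "v_G_PID _ \<longleftrightarrow>
    (\<forall>A :: 'a set. ring_ideal A \<and> A \<noteq> {0} \<longrightarrow> (\<exists>a. v_closure (to_fract ` A) = principal a))"

text \<open>
  The families below are given by their sets of values. The finite family is required to be
  nonempty, because the intersection over the empty set is all of \<open>K\<close>.
\<close>

definition dually_compact :: "'a::idom itself \<Rightarrow> bool" where
  "dually_compact _ \<longleftrightarrow>
    (\<forall>S :: 'a fract set. S \<noteq> {} \<and> 0 \<notin> S \<and> (\<Inter>a\<in>S. principal a) \<noteq> {0} \<longrightarrow>
      (\<exists>X. finite X \<and> X \<noteq> {} \<and> 0 \<notin> X \<and> (\<Inter>a\<in>S. principal a) = (\<Inter>x\<in>X. principal x)))"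

definition primal :: "'a::idom \<Rightarrow> bool" where
  "primal x \<longleftrightarrow> (\<forall>y z. x dvd y * z \<longrightarrow> (\<exists>r s. x = r * s \<and> r dvd y \<and> s dvd z))"

definition integrally_closed :: "'a::idom itself \<Rightarrow> bool" where
  "integrally_closed _ \<longleftrightarrow>
    (\<forall>x :: 'a fract. (\<exists>p :: 'a poly. lead_coeff p = 1 \<and> poly (fract_poly p) x = 0) \<longrightarrow>
      x \<in> base_ring)"

definition schreier_domain :: "'a::idom itself \<Rightarrow> bool" where
  "schreier_domain _ \<longleftrightarrow> integrally_closed TYPE('a) \<and> (\<forall>x :: 'a. x \<noteq> 0 \<longrightarrow> primal x)"

end

theory Submission
  imports Defs
begin

text \<open>
  Both sides are equivalent to the statement that every nonzero intersection \<open>I\<close> of principal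
  fractional ideals is principal; \<open>R\<close> is a \<open>v\<close>-G-PID precisely in this case because
  \<open>\<Inter>\<^sub>\<alpha> (a\<^sub>\<alpha>)\<close> is the inverse of \<open>{a\<^sub>\<alpha>\<^sup>-\<^sup>1}\<close>. If all such intersections are principal, then DC is
  immediate, two elements have a least common multiple and hence all elements are primal, and a
  fraction \<open>x\<close> integral over \<open>R\<close> maps the nonzero principal ideal \<open>\<Inter>\<^sub>i (x\<^sup>-\<^sup>i) = cR\<close> into itself,
  so that \<open>x \<in> R\<close>.

  Conversely, DC applied to \<open>I\<close> and to \<open>I\<^sup>-\<^sup>1\<close> yields finitely many \<open>x\<^sub>i\<close> and \<open>z\<^sub>j\<close> with
  \<open>I = \<Inter>\<^sub>i (x\<^sub>i)\<close> and \<open>I\<^sup>-\<^sup>1 = \<Inter>\<^sub>j (z\<^sub>j\<^sup>-\<^sup>1)\<close>. Here \<open>z\<^sub>j \<in> I\<^sub>v = I\<close>, so every \<open>x\<^sub>i\<close> divides every \<open>z\<^sub>j\<close>.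
  Since nonzero elements are primal, divisibility has the Riesz interpolation property: some \<open>c\<close>
  is a multiple of all \<open>x\<^sub>i\<close> and a divisor of all \<open>z\<^sub>j\<close>, and then \<open>I = (c)\<close>.
\<close>

section \<open>Principal fractional ideals and inverses\<close>

lemma base_ring_to_fract [simp]: "to_fract a \<in> base_ring"
  by (simp add: base_ring_def)

lemma base_ring_0 [simp]: "0 \<in> base_ring"
  using base_ring_to_fract[of 0] by simp

lemma base_ring_1 [simp]: "1 \<in> base_ring"
  using base_ring_to_fract[of 1] by simp

lemma base_ring_add: "x \<in> base_ring \<Longrightarrow> y \<in> base_ring \<Longrightarrow> x + y \<in> base_ring"
  by (auto simp: base_ring_def simp del: to_fract_add simp flip: to_fract_add)

lemma base_ring_mult: "x \<in> base_ring \<Longrightarrow> y \<in> base_ring \<Longrightarrow> x * y \<in> base_ring"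
  by (auto simp: base_ring_def simp del: to_fract_mult simp flip: to_fract_mult)

lemma base_ring_uminus: "x \<in> base_ring \<Longrightarrow> - x \<in> base_ring"
  by (auto simp: base_ring_def simp del: to_fract_uminus simp flip: to_fract_uminus)

lemma base_ring_power: "x \<in> base_ring \<Longrightarrow> x ^ n \<in> base_ring"
  by (induction n) (auto intro: base_ring_mult)

lemma base_ring_sum: "(\<And>i. i \<in> A \<Longrightarrow> f i \<in> base_ring) \<Longrightarrow> sum f A \<in> base_ring"
  by (induction A rule: infinite_finite_induct) (auto intro: base_ring_add)

lemma fract_eq_divide:
  fixes x :: "'a::idom fract"
  obtains a b where "b \<noteq> 0" "x = to_fract a / to_fract b"
  by (cases x) (auto simp: Fract_conv_to_fract)

lemma to_fract_divide_mem_base_ring: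
  assumes "b \<noteq> 0"
  shows "to_fract a / to_fract b \<in> base_ring \<longleftrightarrow> b dvd a"
proof -
  have "to_fract a / to_fract b = to_fract c \<longleftrightarrow> a = b * c" for c
  proof -
    have "to_fract a / to_fract b = to_fract c \<longleftrightarrow> to_fract a = to_fract (b * c)"
      using assms by (auto simp: field_simps)
    then show ?thesis by (simp only: to_fract_eq_iff)
  qed
  then show ?thesis
    by (auto simp: base_ring_def dvd_def image_iff)
qed

lemma mem_principal_iff: "a \<noteq> 0 \<Longrightarrow> x \<in> principal a \<longleftrightarrow> x / a \<in> base_ring"
  by (auto simp: principal_def image_iff intro: bexI[of _ "x / a"])

lemma principal_0 [simp]: "principal 0 = {0}"
  using base_ring_0 by (auto simp: principal_def image_iff simp del: base_ring_0)

lemma zero_mem_principal [simp]: "0 \<in> principal a"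
  by (cases "a = 0") (auto simp: mem_principal_iff)

lemma mem_principal_self [simp]: "a \<in> principal a"
  by (cases "a = 0") (auto simp: mem_principal_iff)

lemma mult_to_fract_mem_principal [simp]: "a * to_fract r \<in> principal a"
  unfolding principal_def by (intro imageI base_ring_to_fract)

lemma principal_trans:
  assumes "y \<in> principal x" "z \<in> principal y"
  shows "z \<in> principal x"
proof -
  from assms obtain r s where "r \<in> base_ring" "y = x * r" "s \<in> base_ring" "z = y * s"
    by (auto simp: principal_def)
  then show ?thesis
    by (auto simp: principal_def mult.assoc intro!: imageI base_ring_mult)
qed

lemma image_mult_principal: "(*) d ` principal a = principal (d * a)"
  by (simp add: principal_def image_image mult.assoc)

section \<open>Inverses of subsets of the quotient field\<close>

lemma mem_frac_inverse_iff: "x \<in> frac_inverse A \<longleftrightarrow> (\<forall>a\<in>A. x * a \<in> base_ring)"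
  by (auto simp: frac_inverse_def)

text \<open>An element \<open>a = 0\<close> imposes no condition on the inverse, yet
  \<open>inverse 0 = 0\<close> would collapse the intersection to \<open>{0}\<close>; hence the
  removal of 0.\<close>

lemma frac_inverse_eq_Inter: "frac_inverse A = (\<Inter>a\<in>A - {0}. principal (inverse a))"
proof -
  have "x * a \<in> base_ring \<longleftrightarrow> a = 0 \<or> x \<in> principal (inverse a)" for a x :: "'a fract"
    by (cases "a = 0") (simp_all add: mem_principal_iff divide_inverse)
  then show ?thesis by (auto simp: mem_frac_inverse_iff)
qed

lemma Inter_principal_eq_frac_inverse:
  assumes "0 \<notin> S"
  shows "(\<Inter>a\<in>S. principal a) = frac_inverse (inverse ` S)"
proof -
  have "inverse ` S - {0} = inverse ` S" using assms by auto
  then show ?thesis by (simp add: frac_inverse_eq_Inter)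
qed

lemma frac_inverse_principal:
  assumes "c \<noteq> 0"
  shows "frac_inverse (principal c) = principal (inverse c)"
proof -
  have "x \<in> frac_inverse (principal c) \<longleftrightarrow> x * c \<in> base_ring" for x
  proof
    assume "x \<in> frac_inverse (principal c)"
    then show "x * c \<in> base_ring"
      unfolding mem_frac_inverse_iff using mem_principal_self by (rule bspec)
  next
    assume "x * c \<in> base_ring"
    then have "x * c * r \<in> base_ring" if "r \<in> base_ring" for r
      using that by (rule base_ring_mult)
    then show "x \<in> frac_inverse (principal c)"
      by (auto simp: mem_frac_inverse_iff principal_def mult.assoc)
  qed
  then show ?thesis
    using assms by (simp add: set_eq_iff mem_principal_iff divide_inverse)
qed

lemma frac_inverse_image_mult:
  assumes "d \<noteq> 0"
  shows "frac_inverse ((*) d ` A) = (*) (inverse d) ` frac_inverse A"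
proof (intro set_eqI iffI)
  fix x assume "x \<in> frac_inverse ((*) d ` A)"
  then have "d * x \<in> frac_inverse A"
    by (simp add: mem_frac_inverse_iff ac_simps)
  then show "x \<in> (*) (inverse d) ` frac_inverse A"
    using assms by (intro image_eqI[of _ _ "d * x"]) (simp_all flip: mult.assoc)
next
  fix x assume "x \<in> (*) (inverse d) ` frac_inverse A"
  then obtain y where y: "y \<in> frac_inverse A" "x = inverse d * y" by blast
  have eq: "inverse d * y * (d * a) = y * a" for y a
    using assms by simp
  from y show "x \<in> frac_inverse ((*) d ` A)"
    by (simp add: mem_frac_inverse_iff eq)
qed

lemma frac_inverse_antimono: "A \<subseteq> B \<Longrightarrow> frac_inverse B \<subseteq> frac_inverse A"
  unfolding frac_inverse_def by blast

lemma subset_frac_inverse_frac_inverse: "A \<subseteq> frac_inverse (frac_inverse A)"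
  by (metis mem_frac_inverse_iff mult.commute subsetI)

text \<open>Inversion forms an antitone Galois connection with itself, so every inverse is its own
  v-closure.\<close>

lemma frac_inverse_frac_inverse_frac_inverse:
  "frac_inverse (frac_inverse (frac_inverse A)) = frac_inverse A"
proof
  show "frac_inverse (frac_inverse (frac_inverse A)) \<subseteq> frac_inverse A"
    by (rule frac_inverse_antimono[OF subset_frac_inverse_frac_inverse])
qed (rule subset_frac_inverse_frac_inverse)

section \<open>Nonzero intersections of principal fractional ideals\<close>

definition principal_inters :: "'a::idom itself \<Rightarrow> bool" where
  "principal_inters _ \<longleftrightarrow>
    (\<forall>S :: 'a fract set. S \<noteq> {} \<and> 0 \<notin> S \<and> (\<Inter>a\<in>S. principal a) \<noteq> {0} \<longrightarrow>
      (\<exists>c. (\<Inter>a\<in>S. principal a) = principal c))"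

lemma principal_intersE:
  fixes S :: "'a::idom fract set"
  assumes "principal_inters TYPE('a)" "S \<noteq> {}" "0 \<notin> S"
    and "d \<in> (\<Inter>a\<in>S. principal a)" "d \<noteq> 0"
  obtains c where "c \<noteq> 0" "(\<Inter>a\<in>S. principal a) = principal c"
proof -
  have "(\<Inter>a\<in>S. principal a) \<noteq> {0}" using assms(4,5) by blast
  with assms(2,3) have "S \<noteq> {} \<and> 0 \<notin> S \<and> (\<Inter>a\<in>S. principal a) \<noteq> {0}"
    by (intro conjI)
  with assms(1) obtain c where c: "(\<Inter>a\<in>S. principal a) = principal c"
    unfolding principal_inters_def by metis
  have "d \<in> principal c" using assms(4) unfolding c .
  with assms(5) have "c \<noteq> 0" by auto
  then show thesis using c by (rule that)
qed

text \<open>The hypothesis concerns only ideals inside R, so the inverse of the intersection I is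
  first scaled into R by a nonzero d in I.\<close>

lemma v_G_PID_imp_principal_inters:
  assumes "v_G_PID TYPE('a::idom)"
  shows "principal_inters TYPE('a)"
  unfolding principal_inters_def
proof (intro allI impI, elim conjE)
  fix S :: "'a fract set"
  assume S: "S \<noteq> {}" "0 \<notin> S" and ne: "(\<Inter>a\<in>S. principal a) \<noteq> {0}"
  define I where "I = (\<Inter>a\<in>S. principal a)"
  have I: "I = frac_inverse (inverse ` S)"
    unfolding I_def by (rule Inter_principal_eq_frac_inverse[OF S(2)])
  have "0 \<in> I" by (simp add: I_def)
  with ne obtain d where d: "d \<in> I" "d \<noteq> 0" unfolding I_def by blast
  define A where "A = {r. to_fract r \<in> (*) d ` frac_inverse I}"
  have A_iff: "r \<in> A \<longleftrightarrow> (\<forall>y\<in>I. to_fract r * y / d \<in> base_ring)" for r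
  proof -
    have "r \<in> A \<longleftrightarrow> to_fract r / d \<in> frac_inverse I"
      using d(2) by (force simp: A_def image_iff field_simps)
    then show ?thesis by (simp add: mem_frac_inverse_iff)
  qed
  have image_A: "to_fract ` A = (*) d ` frac_inverse I"
  proof
    show "(*) d ` frac_inverse I \<subseteq> to_fract ` A"
    proof
      fix x assume x: "x \<in> (*) d ` frac_inverse I"
      then have "x \<in> base_ring"
        using d(1) by (auto simp: mem_frac_inverse_iff mult.commute)
      then obtain r where "x = to_fract r" by (auto simp: base_ring_def)
      with x show "x \<in> to_fract ` A" by (simp add: A_def)
    qed
  qed (auto simp: A_def)
  have "ring_ideal A"
    unfolding ring_ideal_iff
    by (auto simp: A_iff add_divide_distrib distrib_right mult.assoc base_ring_add
        simp flip: times_divide_eq_right intro: base_ring_mult[OF base_ring_to_fract])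
  \<comment> \<open>For s in S, I lies in (s), so 1/s lies in the inverse of I and d/s is a nonzero
    element of the scaled ideal.\<close>
  moreover have "A \<noteq> {0}"
  proof
    assume "A = {0}"
    obtain s where s: "s \<in> S" using S by blast
    then have "inverse s \<in> frac_inverse I"
      by (auto simp: I mem_frac_inverse_iff mult.commute)
    then have "d * inverse s \<in> to_fract ` A" unfolding image_A by (rule imageI)
    with \<open>A = {0}\<close> have "d * inverse s = 0" by simp
    with d(2) s S(2) show False by auto
  qed
  ultimately obtain a where a: "v_closure (to_fract ` A) = principal a"
    using assms unfolding v_G_PID_def by blast
  \<comment> \<open>A scaled inverse is already v-closed, so the v-closure supplied by the
    hypothesis is the ideal itself. Inverting once more then recovers I as (d/a).\<close>
  have dI: "(*) d ` frac_inverse I = principal a"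
    using a d(2)
    by (simp add: v_closure_def image_A frac_inverse_image_mult
        frac_inverse_frac_inverse_frac_inverse)
  have "a \<noteq> 0"
  proof
    assume "a = 0"
    then have "to_fract ` A = to_fract ` {0}" using dI image_A by simp
    then have "A = {0}" by (metis inj_image_eq_iff injI to_fract_eq_iff)
    with \<open>A \<noteq> {0}\<close> show False ..
  qed
  from dI have "frac_inverse ((*) d ` frac_inverse I) = principal (inverse a)"
    using \<open>a \<noteq> 0\<close> by (simp add: frac_inverse_principal)
  then have "(*) (inverse d) ` I = principal (inverse a)"
    using d(2) by (simp add: frac_inverse_image_mult I frac_inverse_frac_inverse_frac_inverse)
  then have "(*) d ` (*) (inverse d) ` I = principal (d * inverse a)"
    by (simp add: image_mult_principal)
  then have "I = principal (d * inverse a)"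
    using d(2) by (simp add: image_image flip: mult.assoc)
  then show "\<exists>c. (\<Inter>a\<in>S. principal a) = principal c" unfolding I_def by blast
qed

text \<open>The inverse of A is an intersection of principal ideals and contains 1 because A lies in
  R. Hence it equals some (c) with c nonzero, and the v-closure is (1/c).\<close>

lemma principal_inters_imp_v_G_PID:
  assumes "principal_inters TYPE('a::idom)"
  shows "v_G_PID TYPE('a)"
  unfolding v_G_PID_def
proof (intro allI impI, elim conjE)
  fix A :: "'a set"
  assume A: "ring_ideal A" "A \<noteq> {0}"
  define S where "S = inverse ` (to_fract ` A - {0})"
  have eq: "frac_inverse (to_fract ` A) = (\<Inter>a\<in>S. principal a)"
    by (simp add: frac_inverse_eq_Inter S_def)
  have "S \<noteq> {}" "0 \<notin> S"
    using A by (auto simp: S_def ring_ideal_iff)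
  moreover have "1 \<in> (\<Inter>a\<in>S. principal a)"
    by (auto simp: mem_frac_inverse_iff simp flip: eq)
  ultimately obtain c where "c \<noteq> 0" "(\<Inter>a\<in>S. principal a) = principal c"
    using principal_intersE[OF assms] zero_neq_one by metis
  then show "\<exists>a. v_closure (to_fract ` A) = principal a"
    by (auto simp: v_closure_def eq frac_inverse_principal)
qed

section \<open>DC and the Schreier property from principal intersections\<close>

lemma principal_inters_imp_dually_compact:
  assumes "principal_inters TYPE('a::idom)"
  shows "dually_compact TYPE('a)"
  unfolding dually_compact_def
proof (intro allI impI)
  fix S :: "'a fract set"
  assume S: "S \<noteq> {} \<and> 0 \<notin> S \<and> (\<Inter>a\<in>S. principal a) \<noteq> {0}"
  with assms obtain c where c: "(\<Inter>a\<in>S. principal a) = principal c"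
    unfolding principal_inters_def by metis
  with S have "c \<noteq> 0" by (metis principal_0)
  then show "\<exists>X. finite X \<and> X \<noteq> {} \<and> 0 \<notin> X \<and>
      (\<Inter>a\<in>S. principal a) = (\<Inter>x\<in>X. principal x)"
    unfolding c by (intro exI[of _ "{c}"]) auto
qed

text \<open>A generator m of (x) \<inter> (y) is a least common multiple. Write m = ys and xy = mr;
  then x = rs and r divides y. As m divides yz, s divides z.\<close>

lemma principal_inters_imp_primal:
  fixes x :: "'a::idom"
  assumes "principal_inters TYPE('a)" "x \<noteq> 0"
  shows "primal x"
  unfolding primal_def
proof (intro allI impI)
  fix y z assume dvd: "x dvd y * z"
  show "\<exists>r s. x = r * s \<and> r dvd y \<and> s dvd z"
  proof (cases "y = 0")
    case True
    then show ?thesis by (intro exI[of _ x] exI[of _ 1]) auto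
  next
    case False
    let ?S = "{to_fract x, to_fract y}"
    have mem: "to_fract w \<in> (\<Inter>a\<in>?S. principal a) \<longleftrightarrow> x dvd w \<and> y dvd w" for w
      using assms(2) False by (simp add: mem_principal_iff to_fract_divide_mem_base_ring)
    have "to_fract (x * y) \<in> (\<Inter>a\<in>?S. principal a)" "to_fract (x * y) \<noteq> 0" "0 \<notin> ?S"
      unfolding mem using assms(2) False by (simp_all del: to_fract_mult)
    then obtain c where c: "c \<noteq> 0" "(\<Inter>a\<in>?S. principal a) = principal c"
      using principal_intersE[OF assms(1) insert_not_empty] by metis
    have "c \<in> (\<Inter>a\<in>?S. principal a)" unfolding c(2) by (rule mem_principal_self)
    then have "c \<in> principal (to_fract x)" by simp
    then obtain m where m: "c = to_fract m"
      by (auto simp: principal_def base_ring_def simp del: to_fract_mult simp flip: to_fract_mult)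
    have "m \<noteq> 0" using c(1) m by auto
    have lcm: "x dvd w \<and> y dvd w \<longleftrightarrow> m dvd w" for w
      using mem[of w] \<open>m \<noteq> 0\<close> unfolding c(2) m
      by (simp add: mem_principal_iff to_fract_divide_mem_base_ring)
    have "x dvd m" "y dvd m" using lcm[of m] by simp_all
    then obtain t s where t: "m = x * t" and s: "m = y * s" by (elim dvdE)
    have "m dvd x * y" using lcm[of "x * y"] by simp
    then obtain r where r: "x * y = m * r" by (elim dvdE)
    from r t have y: "y = t * r" using assms(2) by (simp add: mult.assoc)
    from r s have x: "x = r * s" using False by (simp add: ac_simps)
    have "m dvd y * z" using lcm[of "y * z"] dvd by simp
    with s have "s dvd z" using False by simp
    with x y show ?thesis by (intro exI[of _ r] exI[of _ s]) simp
  qed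
qed

lemma principal_inters_imp_integrally_closed:
  assumes "principal_inters TYPE('a::idom)"
  shows "integrally_closed TYPE('a)"
  unfolding integrally_closed_def
proof (intro allI impI)
  fix x :: "'a fract"
  assume "\<exists>p :: 'a poly. lead_coeff p = 1 \<and> poly (fract_poly p) x = 0"
  then obtain p :: "'a poly" where p: "lead_coeff p = 1" "poly (fract_poly p) x = 0" by blast
  define n where "n = degree p"
  obtain a b where b: "b \<noteq> 0" and x: "x = to_fract a / to_fract b"
    by (rule fract_eq_divide)
  \<comment> \<open>A common denominator of all powers of x: it clears those below n directly, and
    the monic equation reduces the higher ones to them.\<close>
  define y where "y = to_fract b ^ n"
  have "y \<noteq> 0" using b by (simp add: y_def)
  have "(\<Sum>k\<le>n. to_fract (coeff p k) * x ^ k) = 0"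
    using p by (simp add: poly_altdef degree_map_poly coeff_map_poly n_def)
  then have xn: "x ^ n = - (\<Sum>k<n. to_fract (coeff p k) * x ^ k)"
    using p(1) by (simp add: n_def eq_neg_iff_add_eq_0 add.commute flip: lessThan_Suc_atMost)
  have y_mem: "y * x ^ i \<in> base_ring" for i
  proof (induction i rule: less_induct)
    case (less i)
    show ?case
    proof (cases "i < n")
      case True
      then have "y * x ^ i = to_fract b ^ (n - i) * to_fract a ^ i"
        using b by (simp add: y_def x power_divide power_diff)
      then show ?thesis by (simp add: base_ring_mult base_ring_power)
    next
      case False
      then have "y * x ^ i = y * x ^ n * x ^ (i - n)"
        by (simp add: mult.assoc flip: power_add)
      also have "\<dots> = - (\<Sum>k<n. to_fract (coeff p k) * (y * x ^ (k + (i - n))))"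
        by (simp add: xn sum_distrib_left sum_distrib_right power_add ac_simps)
      also have "\<dots> \<in> base_ring"
        \<comment> \<open>The induction hypothesis applies because k < n gives k + (i - n) <
          i.\<close>
        using False by (intro base_ring_uminus base_ring_sum base_ring_mult less) auto
      finally show ?thesis .
    qed
  qed
  show "x \<in> base_ring"
  \<comment> \<open>For x = 0 the family of powers of \<open>inverse x\<close> would contain
    0.\<close>
  proof (cases "x = 0")
    case False
    let ?S = "range (\<lambda>i. inverse x ^ i)"
    have mem: "z \<in> (\<Inter>a\<in>?S. principal a) \<longleftrightarrow> (\<forall>i. z * x ^ i \<in> base_ring)" for z
      using False by (simp add: mem_principal_iff divide_inverse power_inverse)
    have "0 \<notin> ?S" using False by auto
    moreover have "y \<in> (\<Inter>a\<in>?S. principal a)" unfolding mem using y_mem by blast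
    ultimately obtain c where c: "c \<noteq> 0" "(\<Inter>a\<in>?S. principal a) = principal c"
      using principal_intersE[OF assms, of ?S y] \<open>y \<noteq> 0\<close> by blast
    have "\<forall>i. c * x ^ i \<in> base_ring"
      using mem[of c] unfolding c(2) by simp
    \<comment> \<open>The intersection is stable under multiplication by x, so cx is again a
      multiple of c.\<close>
    then have "c * x * x ^ i \<in> base_ring" for i
      by (metis mult.assoc power_Suc)
    then have "c * x \<in> principal c"
      using mem[of "c * x"] unfolding c(2) by simp
    then show ?thesis using c(1) by (simp add: mem_principal_iff)
  qed simp
qed

section \<open>Riesz interpolation\<close>

text \<open>
  The primal element \<open>z\<^sub>1/x\<^sub>1\<close> divides \<open>(z\<^sub>1/x\<^sub>1)(z\<^sub>2/x\<^sub>2) = (z\<^sub>1/x\<^sub>2)(z\<^sub>2/x\<^sub>1)\<close>; if it splits accordingly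
  as \<open>rs\<close>, then \<open>c = x\<^sub>1s = z\<^sub>1/r\<close> interpolates.
\<close>

lemma primal_interpolation:
  fixes x1 x2 z1 z2 :: "'a::idom fract"
  assumes primal: "\<And>x :: 'a. x \<noteq> 0 \<Longrightarrow> primal x"
    and nz: "x1 \<noteq> 0" "x2 \<noteq> 0" "z1 \<noteq> 0" "z2 \<noteq> 0"
    and mem: "z1 \<in> principal x1" "z2 \<in> principal x1" "z1 \<in> principal x2" "z2 \<in> principal x2"
  obtains c where "c \<noteq> 0" "c \<in> principal x1" "c \<in> principal x2"
    "z1 \<in> principal c" "z2 \<in> principal c"
proof -
  obtain p where p: "z1 = x1 * to_fract p" using mem by (auto simp: principal_def base_ring_def)
  obtain q where q: "z2 = x1 * to_fract q" using mem by (auto simp: principal_def base_ring_def)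
  obtain u where u: "z1 = x2 * to_fract u" using mem by (auto simp: principal_def base_ring_def)
  obtain v where v: "z2 = x2 * to_fract v" using mem by (auto simp: principal_def base_ring_def)
  have "x1 * x2 * to_fract (p * v) = x1 * x2 * to_fract (u * q)"
  proof -
    have "x1 * x2 * to_fract (p * v) = z1 * z2"
      by (subst p, subst v) (simp add: ac_simps)
    also have "\<dots> = x1 * x2 * to_fract (u * q)"
      by (subst u, subst q) (simp add: ac_simps)
    finally show ?thesis .
  qed
  then have "p * v = u * q" using nz by (simp del: to_fract_mult)
  then have "p dvd u * q" by (metis dvd_triv_left)
  moreover have "p \<noteq> 0" using nz p by auto
  ultimately obtain r s where rs: "p = r * s" "r dvd u" "s dvd q"
    using primal unfolding primal_def by metis
  from rs obtain u' q' where u': "u = r * u'" and q': "q = s * q'" by (auto elim!: dvdE)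
  have r: "to_fract r \<noteq> 0" and s: "to_fract s \<noteq> 0" using \<open>p \<noteq> 0\<close> rs by auto
  define c where "c = x1 * to_fract s"
  have z1: "z1 = c * to_fract r" by (simp add: c_def p rs ac_simps)
  have "to_fract r * c = to_fract r * (x2 * to_fract u')"
    using z1 u by (auto simp: u' ac_simps)
  then have x2: "c = x2 * to_fract u'" using r by simp
  have z2: "z2 = c * to_fract q'" by (simp add: c_def q q' ac_simps)
  show thesis
  proof (rule that)
    show "c \<noteq> 0" using nz s by (simp add: c_def)
    show "c \<in> principal x1" by (simp add: c_def)
    show "c \<in> principal x2" by (simp add: x2)
    show "z1 \<in> principal c" by (simp add: z1)
    show "z2 \<in> principal c" by (simp add: z2)
  qed
qed

text \<open>By induction, an interpolant c for X stands in for all of X; interpolating between the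
  pairs x, c and z1, z2 adds one more element x.\<close>

lemma primal_interpolation_finite_left:
  fixes X :: "'a::idom fract set"
  assumes primal: "\<And>x :: 'a. x \<noteq> 0 \<Longrightarrow> primal x"
    and "finite X" "X \<noteq> {}" "0 \<notin> X" "z1 \<noteq> 0" "z2 \<noteq> 0"
    and "\<forall>x\<in>X. z1 \<in> principal x \<and> z2 \<in> principal x"
  shows "\<exists>c. c \<noteq> 0 \<and> (\<forall>x\<in>X. c \<in> principal x) \<and> z1 \<in> principal c \<and> z2 \<in> principal c"
  using assms(2-)
proof (induction X rule: finite_ne_induct)
  case (singleton x)
  then show ?case by (intro exI[of _ x]) auto
next
  case (insert x X)
  then obtain c where c: "c \<noteq> 0" "\<forall>x\<in>X. c \<in> principal x" "z1 \<in> principal c" "z2 \<in> principal c"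
    by auto
  have "x \<noteq> 0" "z1 \<in> principal x" "z2 \<in> principal x" using insert.prems by auto
  with c insert.prems obtain d where d: "d \<noteq> 0" "d \<in> principal x" "d \<in> principal c"
      "z1 \<in> principal d" "z2 \<in> principal d"
    using primal_interpolation[OF primal] by metis
  with c(2) show ?case by (auto intro!: exI[of _ d] intro: principal_trans)
qed

text \<open>Induction on the upper set: an interpolant c for Z replaces Z, and the pair c, z is
  interpolated against X.\<close>

lemma primal_interpolation_finite:
  fixes X Z :: "'a::idom fract set"
  assumes primal: "\<And>x :: 'a. x \<noteq> 0 \<Longrightarrow> primal x"
    and X: "finite X" "X \<noteq> {}" "0 \<notin> X"
    and Z: "finite Z" "Z \<noteq> {}" "0 \<notin> Z"
    and "\<forall>x\<in>X. \<forall>z\<in>Z. z \<in> principal x"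
  shows "\<exists>c. c \<noteq> 0 \<and> (\<forall>x\<in>X. c \<in> principal x) \<and> (\<forall>z\<in>Z. z \<in> principal c)"
  using Z assms(8)
proof (induction Z rule: finite_ne_induct)
  case (singleton z)
  then show ?case by (intro exI[of _ z]) auto
next
  case (insert z Z)
  then obtain c where c: "c \<noteq> 0" "\<forall>x\<in>X. c \<in> principal x" "\<forall>z\<in>Z. z \<in> principal c"
    by auto
  moreover have "z \<noteq> 0" "\<forall>x\<in>X. z \<in> principal x" using insert.prems by auto
  ultimately obtain d where "d \<noteq> 0" "\<forall>x\<in>X. d \<in> principal x" "c \<in> principal d" "z \<in> principal d"
    using primal_interpolation_finite_left[OF primal X, of c z] by blast
  with c(3) show ?case by (auto intro!: exI[of _ d] intro: principal_trans)
qed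

section \<open>Principal intersections from DC and primality\<close>

lemma dually_compact_primal_imp_principal_inters:
  assumes dc: "dually_compact TYPE('a::idom)"
    and primal: "\<And>x :: 'a. x \<noteq> 0 \<Longrightarrow> primal x"
  shows "principal_inters TYPE('a)"
  unfolding principal_inters_def
proof (intro allI impI)
  fix S :: "'a fract set"
  assume S: "S \<noteq> {} \<and> 0 \<notin> S \<and> (\<Inter>a\<in>S. principal a) \<noteq> {0}"
  define I where "I = (\<Inter>a\<in>S. principal a)"
  obtain X where X: "finite X" "X \<noteq> {}" "0 \<notin> X" and I_X: "I = (\<Inter>x\<in>X. principal x)"
    using dc S unfolding dually_compact_def I_def by metis
  have I_inv: "I = frac_inverse (inverse ` X)"
    unfolding I_X by (rule Inter_principal_eq_frac_inverse[OF X(3)])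
  \<comment> \<open>The family that presents the inverse of I as an intersection, so that DC applies
    a second time.\<close>
  define T where "T = inverse ` (I - {0})"
  have T: "frac_inverse I = (\<Inter>a\<in>T. principal a)"
    by (simp add: frac_inverse_eq_Inter T_def)
  have "0 \<in> I" by (simp add: I_def)
  with S have "I - {0} \<noteq> {}" unfolding I_def by blast
  then have "T \<noteq> {}" by (simp add: T_def)
  moreover have "0 \<notin> T" by (auto simp: T_def)
  moreover have "frac_inverse I \<noteq> {0}"
  proof -
    obtain x where "x \<in> X" using X(2) by blast
    then have "inverse x \<in> frac_inverse I" "inverse x \<noteq> 0"
      using X(3) by (auto simp: I_inv mem_frac_inverse_iff mult.commute)
    then show ?thesis by blast
  qed
  ultimately obtain Y where Y: "finite Y" "Y \<noteq> {}" "0 \<notin> Y"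
    and inv_Y: "frac_inverse I = (\<Inter>y\<in>Y. principal y)"
    using dc unfolding dually_compact_def T by metis
  define Z where "Z = inverse ` Y"
  have Z: "finite Z" "Z \<noteq> {}" "0 \<notin> Z" using Y by (auto simp: Z_def)
  have inv_Z: "frac_inverse I = frac_inverse Z"
    unfolding inv_Y Z_def by (rule Inter_principal_eq_frac_inverse[OF Y(3)])
  have "Z \<subseteq> frac_inverse (frac_inverse Z)"
    by (rule subset_frac_inverse_frac_inverse)
  \<comment> \<open>Z and I have the same inverse, hence the same v-closure, and I is v-closed as an
    inverse.\<close>
  also have "\<dots> = I"
    using inv_Z by (metis I_inv frac_inverse_frac_inverse_frac_inverse)
  finally have "\<forall>x\<in>X. \<forall>z\<in>Z. z \<in> principal x" by (auto simp: I_X)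
  then obtain c where c: "c \<noteq> 0" "\<forall>x\<in>X. c \<in> principal x" "\<forall>z\<in>Z. z \<in> principal c"
    using primal_interpolation_finite[OF primal X Z] by blast
  \<comment> \<open>As c divides every z in Z, 1/c lies in the inverse of Z, which is that of
    I.\<close>
  have "inverse c \<in> frac_inverse I"
    using c by (auto simp: inv_Z mem_frac_inverse_iff mem_principal_iff divide_inverse mult.commute)
  then have "I \<subseteq> principal c"
    using c(1) by (auto simp: mem_frac_inverse_iff mem_principal_iff divide_inverse mult.commute)
  moreover have "principal c \<subseteq> I"
    using c(2) by (auto simp: I_X intro: principal_trans)
  ultimately show "\<exists>c. (\<Inter>a\<in>S. principal a) = principal c" unfolding I_def by blast
qed

theorem theorem3p4:
  shows "v_G_PID TYPE('a::idom) \<longleftrightarrow> dually_compact TYPE('a) \<and> schreier_domain TYPE('a)"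
proof
  assume "v_G_PID TYPE('a)"
  then have "principal_inters TYPE('a)" by (rule v_G_PID_imp_principal_inters)
  then show "dually_compact TYPE('a) \<and> schreier_domain TYPE('a)"
    by (simp add: schreier_domain_def principal_inters_imp_dually_compact
        principal_inters_imp_integrally_closed principal_inters_imp_primal)
next
  assume "dually_compact TYPE('a) \<and> schreier_domain TYPE('a)"
  then have "principal_inters TYPE('a)"
    by (intro dually_compact_primal_imp_principal_inters) (auto simp: schreier_domain_def)
  then show "v_G_PID TYPE('a)" by (rule principal_inters_imp_v_G_PID)
qed

end
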